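(* Every finite-dimensional algebra $\mathfrak{A}$ over a field contains a largest solvable ideal $\mathrm{Rad}(\mathfrak{A})$ (i.e., a solvable ideal containing every solvable ideal of $\mathfrak{A}$), and it satisfies the following properties: (a) $\mathrm{Rad}(\mathrm{Rad}(\mathfrak{A}))=\mathrm{Rad}(\mathfrak{A})$. (b) $\mathrm{Rad}(\mathfrak{A}/\mathrm{Rad}(\mathfrak{A}))=0$. (c) If $\phi:\mathfrak{A}\to\mathfrak{B}$ is a homomorphism of algebras, then $\phi(\mathrm{Rad}(\mathfrak{A}))\subseteq\mathrm{Rad}(\phi(\mathfrak{A}))$.
   Context: An algebra over a field is a vector space with a bilinear multiplication $(x,y)\mapsto xy$, not assumed associative (and satisfying no further identities). Ideals are two-sided. The derived series of an algebra $\mathfrak{A}$ is $\mathfrak{A}^{(0)}:=\mathfrak{A}$, $\mathfrak{A}^{(n+1)}:=\mathfrak{A}^{(n)}\mathfrak{A}^{(n)}$, where a product of two subspaces denotes the linear span of all products of their elements; $\mathfrak{A}$ is solvable if $\mathfrak{A}^{(r)}=0$ for some non-negative integer $r$. An ideal is solvable if it is solvable as an algebra. *)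

theory Defs
  imports
    "HOL-Algebra.QuotRing"
    "Jordan_Normal_Form.Missing_VectorSpace"
begin

text \<open>
  Algebras use the \<open>module\<close> record of HOL-Algebra, whose field \<open>mult\<close> is the bilinear product.
  The field \<open>one\<close>, which the record inherits from \<open>ring\<close>, carries no meaning here:
  nothing is assumed about it and homomorphisms need not respect it.
\<close>

locale nonassoc_algebra = vectorspace K A for K and A (structure) +
  assumes mult_closed: "\<lbrakk>x \<in> carrier A; y \<in> carrier A\<rbrakk> \<Longrightarrow> x \<otimes> y \<in> carrier A"
    and mult_add_left: "\<lbrakk>x \<in> carrier A; y \<in> carrier A; z \<in> carrier A\<rbrakk>
      \<Longrightarrow> (x \<oplus> y) \<otimes> z = (x \<otimes> z) \<oplus> (y \<otimes> z)"
    and mult_add_right: "\<lbrakk>x \<in> carrier A; y \<in> carrier A; z \<in> carrier A\<rbrakk>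
      \<Longrightarrow> z \<otimes> (x \<oplus> y) = (z \<otimes> x) \<oplus> (z \<otimes> y)"
    and mult_smult_left: "\<lbrakk>c \<in> carrier K; x \<in> carrier A; y \<in> carrier A\<rbrakk>
      \<Longrightarrow> (c \<odot> x) \<otimes> y = c \<odot> (x \<otimes> y)"
    and mult_smult_right: "\<lbrakk>c \<in> carrier K; x \<in> carrier A; y \<in> carrier A\<rbrakk>
      \<Longrightarrow> x \<otimes> (c \<odot> y) = c \<odot> (x \<otimes> y)"

text \<open>The algebra structure of \<open>A\<close> restricted to a multiplicatively closed subspace.\<close>

abbreviation subalg :: "('k, 'a, 'm) module_scheme \<Rightarrow> 'a set \<Rightarrow> ('k, 'a, 'm) module_scheme"
  where "subalg A S \<equiv> A\<lparr>carrier := S\<rparr>"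

definition algebra_ideal ::
    "('k, 'r) ring_scheme \<Rightarrow> ('k, 'a, 'm) module_scheme \<Rightarrow> 'a set \<Rightarrow> bool"
  where "algebra_ideal K A I \<longleftrightarrow> subspace K I A \<and>
    (\<forall>a\<in>carrier A. \<forall>x\<in>I. a \<otimes>\<^bsub>A\<^esub> x \<in> I \<and> x \<otimes>\<^bsub>A\<^esub> a \<in> I)"

definition subspace_mult ::
    "('k, 'r) ring_scheme \<Rightarrow> ('k, 'a, 'm) module_scheme \<Rightarrow> 'a set \<Rightarrow> 'a set \<Rightarrow> 'a set"
  where "subspace_mult K A U V = module.span K A {x \<otimes>\<^bsub>A\<^esub> y | x y. x \<in> U \<and> y \<in> V}"

primrec derived_series ::
    "('k, 'r) ring_scheme \<Rightarrow> ('k, 'a, 'm) module_scheme \<Rightarrow> nat \<Rightarrow> 'a set"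
  where
    "derived_series K A 0 = carrier A"
  | "derived_series K A (Suc n) =
       subspace_mult K A (derived_series K A n) (derived_series K A n)"

definition solvable_algebra :: "('k, 'r) ring_scheme \<Rightarrow> ('k, 'a, 'm) module_scheme \<Rightarrow> bool"
  where "solvable_algebra K A \<longleftrightarrow> (\<exists>r. derived_series K A r = {\<zero>\<^bsub>A\<^esub>})"

definition solvable_ideal ::
    "('k, 'r) ring_scheme \<Rightarrow> ('k, 'a, 'm) module_scheme \<Rightarrow> 'a set \<Rightarrow> bool"
  where "solvable_ideal K A I \<longleftrightarrow> algebra_ideal K A I \<and> solvable_algebra K (subalg A I)"

definition largest_solvable_ideal ::
    "('k, 'r) ring_scheme \<Rightarrow> ('k, 'a, 'm) module_scheme \<Rightarrow> 'a set \<Rightarrow> bool"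
  where "largest_solvable_ideal K A R \<longleftrightarrow>
    solvable_ideal K A R \<and> (\<forall>I. solvable_ideal K A I \<longrightarrow> I \<subseteq> R)"

text \<open>A largest solvable ideal is unique if there is one; otherwise the value is unspecified.\<close>

definition Rad :: "('k, 'r) ring_scheme \<Rightarrow> ('k, 'a, 'm) module_scheme \<Rightarrow> 'a set"
  where "Rad K A = (THE R. largest_solvable_ideal K A R)"

text \<open>
  This extends \<^const>\<open>FactRing\<close> by scalar multiplication. The union over the whole coset, as in
  \<^const>\<open>rcoset_mult\<close>, makes \<open>c\<close> times \<open>I + x\<close> equal to \<open>I + c x\<close> also for \<open>c = 0\<close>, where the
  elementwise multiples of \<open>I + x\<close> would not form a coset.
\<close>

definition quotient_algebra ::
    "('k, 'a, 'm) module_scheme \<Rightarrow> 'a set \<Rightarrow> ('k, 'a set) module"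
  where "quotient_algebra A I =
    \<lparr>carrier = a_rcosets\<^bsub>A\<^esub> I, mult = rcoset_mult A I,
     one = (I +>\<^bsub>A\<^esub> \<one>\<^bsub>A\<^esub>), zero = I, add = set_add A,
     smult = (\<lambda>c X. \<Union>x\<in>X. I +>\<^bsub>A\<^esub> (c \<odot>\<^bsub>A\<^esub> x))\<rparr>"

definition algebra_hom ::
    "('k, 'r) ring_scheme \<Rightarrow> ('k, 'a, 'm) module_scheme \<Rightarrow> ('k, 'b, 'n) module_scheme
      \<Rightarrow> ('a \<Rightarrow> 'b) set"
  where "algebra_hom K A B = {f \<in> module_hom K A B.
    \<forall>x\<in>carrier A. \<forall>y\<in>carrier A. f (x \<otimes>\<^bsub>A\<^esub> y) = f x \<otimes>\<^bsub>B\<^esub> f y}"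

end

theory Submission
  imports Defs
begin

text \<open>
  The derived series of a subalgebra \<open>S\<close> can be computed in the ambient algebra by iterating
  \<open>U \<mapsto> U U\<close> from \<open>S\<close>. For ideals, modulo \<open>J\<close> the series of \<open>I + J\<close> is that of \<open>I\<close>, so sums of
  solvable ideals are solvable, and in finite dimension there is a largest one. Homomorphisms commute
  with the iteration: this gives (c), and it shows that the preimage of a solvable ideal under a
  homomorphism with solvable kernel is solvable, which applied to the projection gives (b).
\<close>

section \<open>Repeated squaring of a subspace\<close>

definition iterated_square ::
    "('k, 'r) ring_scheme \<Rightarrow> ('k, 'a, 'm) module_scheme \<Rightarrow> nat \<Rightarrow> 'a set \<Rightarrow> 'a set"
  where "iterated_square K A n S = ((\<lambda>U. subspace_mult K A U U) ^^ n) S"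

lemma iterated_square_0 [simp]: "iterated_square K A 0 S = S"
  by (simp add: iterated_square_def)

lemma iterated_square_Suc [simp]:
  "iterated_square K A (Suc n) S =
    subspace_mult K A (iterated_square K A n S) (iterated_square K A n S)"
  by (simp add: iterated_square_def)

text \<open>This splitting is what lets solvability be proved in two stages: first descend into an
  ideal, then descend to zero inside it.\<close>

lemma iterated_square_add:
  "iterated_square K A (m + n) S = iterated_square K A m (iterated_square K A n S)"
  by (simp add: iterated_square_def funpow_add)

section \<open>Subspaces, spans and linear maps\<close>

lemma (in vectorspace) subspaceI:
  assumes "S \<subseteq> carrier V" "\<zero>\<^bsub>V\<^esub> \<in> S"
    and "\<And>x y. \<lbrakk>x \<in> S; y \<in> S\<rbrakk> \<Longrightarrow> x \<oplus>\<^bsub>V\<^esub> y \<in> S"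
    and "\<And>c x. \<lbrakk>c \<in> carrier K; x \<in> S\<rbrakk> \<Longrightarrow> c \<odot>\<^bsub>V\<^esub> x \<in> S"
  shows "subspace K S V"
  using assms by (intro subspace.intro submodule.intro vectorspace_axioms module_axioms)

lemma
  assumes "subspace K S V"
  shows subspace_subset: "S \<subseteq> carrier V"
    and subspace_zero: "\<zero>\<^bsub>V\<^esub> \<in> S"
    and subspace_add: "\<lbrakk>x \<in> S; y \<in> S\<rbrakk> \<Longrightarrow> x \<oplus>\<^bsub>V\<^esub> y \<in> S"
    and subspace_smult: "\<lbrakk>c \<in> carrier K; x \<in> S\<rbrakk> \<Longrightarrow> c \<odot>\<^bsub>V\<^esub> x \<in> S"
  using subspace.submod[OF assms] by (auto simp: submodule_def)

lemma (in vectorspace) subspace_a_inv: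
  assumes "subspace K S V" "x \<in> S"
  shows "\<ominus>\<^bsub>V\<^esub> x \<in> S"
proof -
  have "x \<in> carrier V"
    using assms subspace_subset by blast
  moreover have "(\<ominus>\<^bsub>K\<^esub> \<one>\<^bsub>K\<^esub>) \<odot>\<^bsub>V\<^esub> x \<in> S"
    using assms by (auto intro: subspace_smult)
  ultimately show ?thesis
    by (simp add: smult_l_minus)
qed

lemma (in vectorspace) subspace_zero_set: "subspace K {\<zero>\<^bsub>V\<^esub>} V"
  by (rule subspaceI) auto

lemma (in vectorspace) span_subset_subspace:
  "\<lbrakk>X \<subseteq> S; subspace K S V\<rbrakk> \<Longrightarrow> span X \<subseteq> S"
  by (simp add: span_is_subset)

lemma (in vectorspace) submodule_sumI:
  "\<lbrakk>x \<in> S; y \<in> T\<rbrakk> \<Longrightarrow> x \<oplus>\<^bsub>V\<^esub> y \<in> submodule_sum S T"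
  by (force simp: submodule_sum_def)

lemma (in vectorspace) submodule_sumE:
  assumes "z \<in> submodule_sum S T"
  obtains x y where "x \<in> S" "y \<in> T" "z = x \<oplus>\<^bsub>V\<^esub> y"
  using assms by (auto simp: submodule_sum_def)

lemma (in linear_map) subspace_image:
  assumes S: "subspace K S V"
  shows "subspace K (T ` S) W"
proof (rule W.subspaceI)
  have car: "x \<in> carrier V" if "x \<in> S" for x
    using S that subspace_subset by blast
  show "T ` S \<subseteq> carrier W"
    using car by auto
  show "\<zero>\<^bsub>W\<^esub> \<in> T ` S"
    using subspace_zero[OF S] T0_is_0 by (metis imageI)
  show "x \<oplus>\<^bsub>W\<^esub> y \<in> T ` S" if "x \<in> T ` S" "y \<in> T ` S" for x y
    using that subspace_add[OF S] car by (auto simp flip: T_add)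
  show "c \<odot>\<^bsub>W\<^esub> x \<in> T ` S" if "c \<in> carrier K" "x \<in> T ` S" for c x
    using that subspace_smult[OF S] car by (auto simp flip: T_smult)
qed

lemma (in linear_map) subspace_vimage:
  assumes S: "subspace K S W"
  shows "subspace K {x \<in> carrier V. T x \<in> S} V"
  using S by (intro V.subspaceI) (auto simp: subspace_add subspace_smult subspace_zero)

text \<open>Both inclusions use that a span is the least subspace containing its generators: the
  preimage of the right-hand span is a subspace containing \<open>X\<close>, and the image of
  \<open>span X\<close> is a subspace containing the image of \<open>X\<close>.\<close>

lemma (in linear_map) image_span:
  assumes X: "X \<subseteq> carrier V"
  shows "T ` V.module.span X = W.module.span (T ` X)"
proof
  have TX: "T ` X \<subseteq> carrier W"
    using X by auto
  have "V.module.span X \<subseteq> {x \<in> carrier V. T x \<in> W.module.span (T ` X)}"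
    using X W.module.in_own_span[OF TX]
    by (intro V.span_subset_subspace subspace_vimage W.span_is_subspace TX) auto
  then show "T ` V.module.span X \<subseteq> W.module.span (T ` X)"
    by auto
  show "W.module.span (T ` X) \<subseteq> T ` V.module.span X"
    using V.module.in_own_span[OF X]
    by (intro W.span_subset_subspace subspace_image V.span_is_subspace X) auto
qed

section \<open>Products of subspaces and the derived series\<close>

context nonassoc_algebra
begin

lemma products_subset:
  "\<lbrakk>U \<subseteq> carrier A; W \<subseteq> carrier A\<rbrakk> \<Longrightarrow> {x \<otimes> y | x y. x \<in> U \<and> y \<in> W} \<subseteq> carrier A"
  by (auto intro: mult_closed)

text \<open>A product of subspaces is a span, so for an inclusion into a subspace only single
  products have to be checked.\<close>

lemma subspace_mult_subset:
  assumes "subspace K S A" "\<And>x y. \<lbrakk>x \<in> U; y \<in> W\<rbrakk> \<Longrightarrow> x \<otimes> y \<in> S"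
  shows "subspace_mult K A U W \<subseteq> S"
  unfolding subspace_mult_def by (rule span_subset_subspace) (use assms in auto)

lemma subspace_subspace_mult:
  "\<lbrakk>U \<subseteq> carrier A; W \<subseteq> carrier A\<rbrakk> \<Longrightarrow> subspace K (subspace_mult K A U W) A"
  unfolding subspace_mult_def by (intro span_is_subspace products_subset)

lemma mult_in_subspace_mult:
  "\<lbrakk>U \<subseteq> carrier A; W \<subseteq> carrier A; x \<in> U; y \<in> W\<rbrakk> \<Longrightarrow> x \<otimes> y \<in> subspace_mult K A U W"
  unfolding subspace_mult_def by (rule subsetD[OF in_own_span[OF products_subset]]) auto

lemma subspace_mult_mono:
  "\<lbrakk>U \<subseteq> U'; W \<subseteq> W'\<rbrakk> \<Longrightarrow> subspace_mult K A U W \<subseteq> subspace_mult K A U' W'"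
  unfolding subspace_mult_def by (rule span_is_monotone) auto

lemma iterated_square_mono:
  "S \<subseteq> T \<Longrightarrow> iterated_square K A n S \<subseteq> iterated_square K A n T"
  by (induction n) (simp_all add: subspace_mult_mono)

lemma subspace_iterated_square:
  "subspace K S A \<Longrightarrow> subspace K (iterated_square K A n S) A"
  by (induction n) (simp_all add: subspace_subspace_mult subspace_subset)

lemma iterated_square_subset:
  assumes "subspace K S A" "\<And>x y. \<lbrakk>x \<in> S; y \<in> S\<rbrakk> \<Longrightarrow> x \<otimes> y \<in> S"
  shows "iterated_square K A n S \<subseteq> S"
proof (induction n)
  case (Suc n)
  then show ?case
    by (auto intro!: subspace_mult_subset assms del: subsetI)
qed simp

text \<open>Solvability asks for equality with the zero space; as every term is a subspace and
  contains zero, an inclusion is enough.\<close>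

lemma iterated_square_zeroI:
  assumes "subspace K S A" "iterated_square K A n S \<subseteq> {\<zero>}"
  shows "iterated_square K A n S = {\<zero>}"
  using assms subspace_zero[OF subspace_iterated_square] by blast

lemma derived_series_subalg:
  assumes S: "subspace K S A" and mult: "\<And>x y. \<lbrakk>x \<in> S; y \<in> S\<rbrakk> \<Longrightarrow> x \<otimes> y \<in> S"
  shows "derived_series K (subalg A S) n = iterated_square K A n S"
proof (induction n)
  case (Suc n)
  \<comment> \<open>The generators lie in \<open>S\<close>, so their span is the same whether taken
    in \<open>subalg A S\<close> or in \<open>A\<close>.\<close>
  have "{x \<otimes> y | x y. x \<in> iterated_square K A n S \<and> y \<in> iterated_square K A n S} \<subseteq> S"
    using iterated_square_subset[OF assms, of n] mult by blast
  then show ?case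
    using S Suc by (simp add: subspace_mult_def span_li_not_depend(1))
qed simp

lemma solvable_subalg_iff:
  assumes "subspace K S A" "\<And>x y. \<lbrakk>x \<in> S; y \<in> S\<rbrakk> \<Longrightarrow> x \<otimes> y \<in> S"
  shows "solvable_algebra K (subalg A S) \<longleftrightarrow> (\<exists>n. iterated_square K A n S = {\<zero>})"
  by (simp add: solvable_algebra_def derived_series_subalg[OF assms])

text \<open>Makes the results on algebras available inside an ideal and inside the image of a
  homomorphism.\<close>

lemma subalg_nonassoc_algebra:
  assumes S: "subspace K S A" and mult: "\<And>x y. \<lbrakk>x \<in> S; y \<in> S\<rbrakk> \<Longrightarrow> x \<otimes> y \<in> S"
  shows "nonassoc_algebra K (subalg A S)"
proof -
  have "x \<in> carrier A" if "x \<in> S" for x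
    using that subspace_subset[OF S] by blast
  then show ?thesis
    using subspace_is_vs[OF S] mult
    by (intro nonassoc_algebra.intro nonassoc_algebra_axioms.intro)
      (auto simp: mult_add_left mult_add_right mult_smult_left mult_smult_right)
qed

section \<open>Solvable ideals and their sums\<close>

lemma algebra_idealD:
  assumes "algebra_ideal K A I"
  shows "subspace K I A"
    and "\<lbrakk>a \<in> carrier A; x \<in> I\<rbrakk> \<Longrightarrow> a \<otimes> x \<in> I"
    and "\<lbrakk>a \<in> carrier A; x \<in> I\<rbrakk> \<Longrightarrow> x \<otimes> a \<in> I"
    and "\<lbrakk>x \<in> I; y \<in> I\<rbrakk> \<Longrightarrow> x \<otimes> y \<in> I"
  using assms subspace_subset unfolding algebra_ideal_def by blast+

lemma solvable_ideal_iff: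
  "solvable_ideal K A I \<longleftrightarrow>
    algebra_ideal K A I \<and> (\<exists>n. iterated_square K A n I = {\<zero>})"
  unfolding solvable_ideal_def using solvable_subalg_iff[OF algebra_idealD(1,4)] by blast

lemma solvable_ideal_subset: "solvable_ideal K A I \<Longrightarrow> I \<subseteq> carrier A"
  using subspace_subset[OF algebra_idealD(1)] by (simp add: solvable_ideal_iff)

text \<open>The zero vector is the scalar 0 times itself, and by bilinearity that scalar can be
  pulled out of the product.\<close>

lemma mult_zero [simp]:
  assumes "x \<in> carrier A"
  shows "\<zero> \<otimes> x = \<zero>" "x \<otimes> \<zero> = \<zero>"
proof -
  show "\<zero> \<otimes> x = \<zero>"
    using mult_smult_left[of "\<zero>\<^bsub>K\<^esub>" \<zero> x] assms mult_closed by simp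
  show "x \<otimes> \<zero> = \<zero>"
    using mult_smult_right[of "\<zero>\<^bsub>K\<^esub>" x \<zero>] assms mult_closed by simp
qed

lemma algebra_ideal_zero: "algebra_ideal K A {\<zero>}"
  by (simp add: algebra_ideal_def subspace_zero_set)

text \<open>Zero steps suffice. This ideal starts the search for a largest one and later serves as
  the radical of the quotient.\<close>

lemma solvable_ideal_zero: "solvable_ideal K A {\<zero>}"
  using algebra_ideal_zero by (auto simp: solvable_ideal_iff intro: exI[of _ 0])

text \<open>After \<open>n\<close> steps the series of \<open>S\<close> is inside \<open>I\<close>,
  and by monotonicity \<open>m\<close> further steps reach zero. Sums of ideals and preimages under
  homomorphisms are both handled this way.\<close>

lemma iterated_square_solvable:
  assumes S: "subspace K S A" and I: "iterated_square K A n S \<subseteq> I"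
    and solv: "iterated_square K A m I = {\<zero>}"
  shows "iterated_square K A (m + n) S = {\<zero>}"
  using iterated_square_mono[OF I, of m] solv
  by (intro iterated_square_zeroI[OF S]) (simp add: iterated_square_add)

lemma algebra_ideal_sum:
  assumes I: "algebra_ideal K A I" and J: "algebra_ideal K A J"
  shows "algebra_ideal K A (submodule_sum I J)"
proof -
  note sub = subspace_subset[OF algebra_idealD(1)[OF I]] subspace_subset[OF algebra_idealD(1)[OF J]]
  have "a \<otimes> z \<in> submodule_sum I J \<and> z \<otimes> a \<in> submodule_sum I J"
    if a: "a \<in> carrier A" and z: "z \<in> submodule_sum I J" for a z
  proof -
    from z obtain x y where xy: "x \<in> I" "y \<in> J" "z = x \<oplus> y"
      by (rule submodule_sumE)
    moreover from this have "x \<in> carrier A" "y \<in> carrier A"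
      using sub by auto
    ultimately show ?thesis
      using a algebra_idealD(2,3)[OF I] algebra_idealD(2,3)[OF J]
      by (simp add: mult_add_left mult_add_right submodule_sumI)
  qed
  then show ?thesis
    using I J by (simp add: algebra_ideal_def sum_is_subspace)
qed

text \<open>\<open>J\<close> absorbs every product with a factor in \<open>J\<close>, so squaring
  acts only on the \<open>I\<close> component: (a + j)(b + k) is ab plus an element of
  \<open>J\<close>.\<close>

lemma iterated_square_sum_subset:
  assumes I: "algebra_ideal K A I" and J: "algebra_ideal K A J"
  shows "iterated_square K A n (submodule_sum I J) \<subseteq> submodule_sum (iterated_square K A n I) J"
proof (induction n)
  case (Suc n)
  note sI = algebra_idealD(1)[OF I] and sJ = algebra_idealD(1)[OF J]
  let ?D = "iterated_square K A n I"
  have D: "?D \<subseteq> carrier A"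
    by (rule subspace_subset[OF subspace_iterated_square[OF sI]])
  have "x \<otimes> y \<in> submodule_sum (subspace_mult K A ?D ?D) J"
    if xy: "x \<in> iterated_square K A n (submodule_sum I J)"
      "y \<in> iterated_square K A n (submodule_sum I J)" for x y
  proof -
    from xy Suc obtain a b j k where
      eq: "a \<in> ?D" "j \<in> J" "x = a \<oplus> j" "b \<in> ?D" "k \<in> J" "y = b \<oplus> k"
      by (meson submodule_sumE subsetD)
    then have car: "a \<in> carrier A" "b \<in> carrier A" "j \<in> carrier A" "k \<in> carrier A"
      using D subspace_subset[OF sJ] by auto
    \<comment> \<open>Apart from \<open>a \<otimes> b\<close>, each term has a factor in
      \<open>J\<close>: \<open>k\<close> on the right in the first, \<open>j\<close> on the left in
      the second, so both sides of the ideal property are used.\<close>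
    have "x \<otimes> y = a \<otimes> b \<oplus> (a \<otimes> k \<oplus> j \<otimes> (b \<oplus> k))"
      using car by (simp add: eq mult_add_left mult_add_right mult_closed M.a_ac)
    moreover have "a \<otimes> k \<oplus> j \<otimes> (b \<oplus> k) \<in> J"
      using car eq by (intro subspace_add[OF sJ] algebra_idealD(2,3)[OF J]) auto
    moreover have "a \<otimes> b \<in> subspace_mult K A ?D ?D"
      by (intro mult_in_subspace_mult D eq)
    ultimately show ?thesis
      by (simp add: submodule_sumI)
  qed
  then show ?case
    by (auto intro!: subspace_mult_subset sum_is_subspace subspace_subspace_mult D sJ del: subsetI)
qed simp

text \<open>Once the series of \<open>I\<close> has reached zero, that of the sum lies in 0 +
  \<open>J\<close> = \<open>J\<close>, which is solvable.\<close>

lemma solvable_ideal_sum: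
  assumes "solvable_ideal K A I" "solvable_ideal K A J"
  shows "solvable_ideal K A (submodule_sum I J)"
proof -
  from assms obtain m n where I: "algebra_ideal K A I" and J: "algebra_ideal K A J"
    and m: "iterated_square K A m I = {\<zero>}" and n: "iterated_square K A n J = {\<zero>}"
    by (auto simp: solvable_ideal_iff)
  have "submodule_sum {\<zero>} J \<subseteq> J"
    using subspace_subset[OF algebra_idealD(1)[OF J]] by (auto elim!: submodule_sumE)
  with iterated_square_sum_subset[OF I J, of m] m
  have "iterated_square K A m (submodule_sum I J) \<subseteq> J"
    by simp
  from iterated_square_solvable[OF _ this n] show ?thesis
    using algebra_ideal_sum[OF I J] by (auto simp: solvable_ideal_iff algebra_idealD(1))
qed

text \<open>Instead of a solvable ideal of maximal dimension, take one containing a linearly independent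
  set \<open>L\<close> of maximal size: adding another solvable ideal cannot enlarge \<open>L\<close>.\<close>

lemma ex_largest_solvable_ideal:
  assumes fin_dim
  shows "\<exists>R. largest_solvable_ideal K A R"
proof -
  let ?P = "\<lambda>L. lin_indpt L \<and> (\<exists>I. solvable_ideal K A I \<and> L \<subseteq> I)"
  have "?P {}"
    using solvable_ideal_zero by (auto simp: lin_dep_def)
  \<comment> \<open>Independent sets have at most \<open>dim\<close> elements; the principle for
    greatest values wants a strict bound, hence \<open>Suc dim\<close>.\<close>
  moreover have "\<forall>L. ?P L \<longrightarrow> card L < Suc dim"
    using li_le_dim(2)[OF assms] solvable_ideal_subset by (meson le_imp_less_Suc order_trans)
  ultimately obtain L where L: "?P L" and max: "\<And>L'. ?P L' \<Longrightarrow> card L' \<le> card L"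
    using Lattices_Big.ex_has_greatest_nat[of ?P "{}" card "Suc dim"] by blast
  \<comment> \<open>Every solvable ideal \<open>J\<close> will turn out to satisfy
    \<open>J \<subseteq> span L \<subseteq> R\<close>.\<close>
  from L obtain R where R: "solvable_ideal K A R" and LR: "L \<subseteq> R"
    by blast
  have Lcar: "L \<subseteq> carrier A"
    using LR solvable_ideal_subset[OF R] by blast
  \<comment> \<open>Finiteness ensures that inserting a new vector raises \<open>card\<close>, which
    is 0 on infinite sets.\<close>
  have finL: "finite L"
    using L Lcar assms fin_dim_li_fin by blast
  have "J \<subseteq> R" if J: "solvable_ideal K A J" for J
  proof
    fix v assume v: "v \<in> J"
    have sR: "subspace K R A" and sJ: "subspace K J A"
      using R J by (auto simp: solvable_ideal_iff algebra_idealD(1))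
    have "v \<in> span L"
    proof (rule ccontr)
      assume nin: "v \<notin> span L"
      then have "v \<notin> L"
        using in_own_span[OF Lcar] by blast
      moreover have "v \<in> carrier A"
        using v solvable_ideal_subset[OF J] by blast
      ultimately have "lin_indpt (L \<union> {v})"
        using L Lcar nin lin_dep_iff_in_span by blast
      \<comment> \<open>The solvable ideal R + J contains both \<open>L\<close> and
        \<open>v\<close>, so it makes the enlarged set a competitor of \<open>L\<close>.\<close>
      moreover have "L \<union> {v} \<subseteq> submodule_sum R J"
        using LR v in_sum_vs[OF sR sJ] in_sum_vs[OF sJ sR] vsum_comm[OF sR sJ] by auto
      ultimately have "card (L \<union> {v}) \<le> card L"
        using solvable_ideal_sum[OF R J] by (intro max) blast
      with \<open>v \<notin> L\<close> finL show False
        by simp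
    qed
    then show "v \<in> R"
      using span_subset_subspace[OF LR sR] by blast
  qed
  with R show ?thesis
    by (auto simp: largest_solvable_ideal_def)
qed

end

section \<open>Existence of the radical, and the radical of a solvable ideal\<close>

lemma Rad_eqI: "largest_solvable_ideal K A R \<Longrightarrow> Rad K A = R"
  unfolding Rad_def largest_solvable_ideal_def by (rule the_equality) blast+

lemma (in nonassoc_algebra) Rad_largest_solvable_ideal:
  "fin_dim \<Longrightarrow> largest_solvable_ideal K A (Rad K A)"
  using ex_largest_solvable_ideal Rad_eqI by metis

text \<open>\<open>R\<close> is a solvable ideal of itself, and any other ideal of
  \<open>subalg A R\<close> lies in its carrier, which is \<open>R\<close>. Property (a) is the case
  where \<open>R\<close> is the radical.\<close>

lemma (in nonassoc_algebra) Rad_subalg_solvable_ideal: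
  assumes "solvable_ideal K A R"
  shows "Rad K (subalg A R) = R"
proof (rule Rad_eqI)
  have R: "algebra_ideal K A R" and "solvable_algebra K (subalg A R)"
    using assms by (auto simp: solvable_ideal_def)
  interpret R: nonassoc_algebra K "subalg A R"
    by (rule subalg_nonassoc_algebra) (use R algebra_idealD in auto)
  have "subspace K R (subalg A R)"
    using subspace_zero subspace_add subspace_smult algebra_idealD(1)[OF R]
    by (intro R.subspaceI) auto
  then have "solvable_ideal K (subalg A R) R"
    using \<open>solvable_algebra K (subalg A R)\<close> algebra_idealD(4)[OF R]
    by (simp add: solvable_ideal_def algebra_ideal_def)
  then show "largest_solvable_ideal K (subalg A R) R"
    using R.solvable_ideal_subset by (simp add: largest_solvable_ideal_def)
qed

section \<open>Images and preimages of solvable ideals\<close>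

locale nonassoc_algebra_hom = A?: nonassoc_algebra K A + B: nonassoc_algebra K B
  for K and A (structure) and B +
  fixes \<phi>
  assumes hom: "\<phi> \<in> algebra_hom K A B"
begin

sublocale lin: linear_map K A B \<phi>
  using hom by unfold_locales (simp add: algebra_hom_def)

lemma hom_mult: "\<lbrakk>x \<in> carrier A; y \<in> carrier A\<rbrakk> \<Longrightarrow> \<phi> (x \<otimes> y) = \<phi> x \<otimes>\<^bsub>B\<^esub> \<phi> y"
  using hom by (simp add: algebra_hom_def)

text \<open>A homomorphism maps the generating products onto the generating products, and a linear
  map commutes with spans.\<close>

lemma image_subspace_mult:
  assumes U: "U \<subseteq> carrier A" and W: "W \<subseteq> carrier A"
  shows "\<phi> ` subspace_mult K A U W = subspace_mult K B (\<phi> ` U) (\<phi> ` W)"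
proof -
  have "\<phi> ` {x \<otimes> y | x y. x \<in> U \<and> y \<in> W} =
      {x \<otimes>\<^bsub>B\<^esub> y | x y. x \<in> \<phi> ` U \<and> y \<in> \<phi> ` W}" (is "?L = ?R")
  proof
    show "?L \<subseteq> ?R"
      using U W by (force simp: hom_mult)
    show "?R \<subseteq> ?L"
    proof
      fix z assume "z \<in> ?R"
      then obtain x y where "x \<in> U" "y \<in> W" "z = \<phi> x \<otimes>\<^bsub>B\<^esub> \<phi> y"
        by blast
      moreover from this have "z = \<phi> (x \<otimes> y)"
        using U W hom_mult by (metis subsetD)
      ultimately show "z \<in> ?L"
        by blast
    qed
  qed
  then show ?thesis
    by (simp add: subspace_mult_def lin.image_span[OF products_subset[OF U W]])
qed

lemma image_iterated_square:
  assumes "subspace K S A"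
  shows "\<phi> ` iterated_square K A n S = iterated_square K B n (\<phi> ` S)"
  by (induction n)
    (simp_all add: image_subspace_mult subspace_subset[OF subspace_iterated_square[OF assms]])

text \<open>By surjectivity every element of \<open>B\<close> that multiplies the image of
  \<open>I\<close> comes from \<open>A\<close>, where \<open>I\<close> absorbs products.\<close>

lemma algebra_ideal_image:
  assumes surj: "\<phi> ` carrier A = carrier B" and I: "algebra_ideal K A I"
  shows "algebra_ideal K B (\<phi> ` I)"
proof -
  have "b \<otimes>\<^bsub>B\<^esub> y \<in> \<phi> ` I \<and> y \<otimes>\<^bsub>B\<^esub> b \<in> \<phi> ` I" if "b \<in> carrier B" "y \<in> \<phi> ` I" for b y
  proof -
    from that surj obtain a x where ax: "a \<in> carrier A" "b = \<phi> a" "x \<in> I" "y = \<phi> x"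
      by blast
    then have "x \<in> carrier A"
      using subspace_subset[OF algebra_idealD(1)[OF I]] by blast
    with ax show ?thesis
      using algebra_idealD(2,3)[OF I] by (auto simp flip: hom_mult)
  qed
  then show ?thesis
    using lin.subspace_image[OF algebra_idealD(1)[OF I]] by (auto simp: algebra_ideal_def)
qed

lemma algebra_ideal_vimage:
  assumes J: "algebra_ideal K B J"
  shows "algebra_ideal K A {x \<in> carrier A. \<phi> x \<in> J}"
  using lin.subspace_vimage[OF B.algebra_idealD(1)[OF J]] B.algebra_idealD(2,3)[OF J]
  by (auto simp: algebra_ideal_def hom_mult mult_closed)

text \<open>The series of the image is the image of the series, so it vanishes when the series of
  \<open>I\<close> does.\<close>

lemma solvable_ideal_image:
  assumes surj: "\<phi> ` carrier A = carrier B" and I: "solvable_ideal K A I"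
  shows "solvable_ideal K B (\<phi> ` I)"
proof -
  from I obtain n where "algebra_ideal K A I" and n: "iterated_square K A n I = {\<zero>}"
    by (auto simp: solvable_ideal_iff)
  moreover from this have "iterated_square K B n (\<phi> ` I) = \<phi> ` {\<zero>}"
    by (metis image_iterated_square algebra_idealD(1))
  ultimately show ?thesis
    using algebra_ideal_image[OF surj] by (auto simp: B.solvable_ideal_iff)
qed

text \<open>As many steps as annihilate \<open>J\<close> take the preimage into the kernel; the
  steps that annihilate the kernel finish the descent.\<close>

lemma solvable_ideal_vimage:
  assumes ker: "solvable_ideal K A {x \<in> carrier A. \<phi> x = \<zero>\<^bsub>B\<^esub>}" and J: "solvable_ideal K B J"
  shows "solvable_ideal K A {x \<in> carrier A. \<phi> x \<in> J}"
proof -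
  let ?P = "{x \<in> carrier A. \<phi> x \<in> J}" and ?N = "{x \<in> carrier A. \<phi> x = \<zero>\<^bsub>B\<^esub>}"
  from J obtain n where J: "algebra_ideal K B J" and n: "iterated_square K B n J = {\<zero>\<^bsub>B\<^esub>}"
    by (auto simp: B.solvable_ideal_iff)
  from ker obtain m where m: "iterated_square K A m ?N = {\<zero>}"
    by (auto simp: solvable_ideal_iff)
  have P: "algebra_ideal K A ?P"
    by (rule algebra_ideal_vimage[OF J])
  note sP = algebra_idealD(1)[OF P]
  \<comment> \<open>The image of \<open>?P\<close> may be a proper subset of \<open>J\<close>, so
    monotonicity replaces equality here.\<close>
  have "\<phi> ` iterated_square K A n ?P \<subseteq> iterated_square K B n J"
    unfolding image_iterated_square[OF sP] by (rule B.iterated_square_mono) auto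
  moreover have "iterated_square K A n ?P \<subseteq> carrier A"
    by (rule subspace_subset[OF subspace_iterated_square[OF sP]])
  ultimately have "iterated_square K A n ?P \<subseteq> ?N"
    using n by auto
  from iterated_square_solvable[OF sP this m] P show ?thesis
    by (auto simp: solvable_ideal_iff)
qed

text \<open>Guarantees that the image algebra has a radical of its own, as property (c)
  presupposes.\<close>

lemma fin_dim_image:
  assumes "\<phi> ` carrier A = carrier B" "fin_dim"
  shows "B.fin_dim"
  using lin.surj_fin_dim assms by blast

end

section \<open>Cosets and the quotient algebra\<close>

context nonassoc_algebra
begin

lemma abelian_subgroup_ideal:
  assumes "algebra_ideal K A I"
  shows "abelian_subgroup I A"
proof -
  note sI = algebra_idealD(1)[OF assms]
  have "subgroup I (add_monoid A)"
    using subspace_subset[OF sI] subspace_zero[OF sI] subspace_add[OF sI] subspace_a_inv[OF sI]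
    by (intro M.add.subgroupI) auto
  then show ?thesis
    by (intro abelian_subgroupI3 additive_subgroup.intro M.abelian_group_axioms)
qed

text \<open>Products and scalar multiples in the quotient are unions of cosets. If all
  representatives \<open>f z\<close> lie in one coset, the cosets united are all equal to it;
  nonemptiness of \<open>X\<close> excludes the empty union.\<close>

lemma UN_coset_eq:
  assumes I: "algebra_ideal K A I" and X: "X \<noteq> {}" and w: "w \<in> carrier A"
    and f: "\<And>z. z \<in> X \<Longrightarrow> f z \<in> I +> w"
  shows "(\<Union>z\<in>X. I +> f z) = I +> w"
proof -
  interpret I: abelian_subgroup I A
    by (rule abelian_subgroup_ideal[OF I])
  have "I +> f z = I +> w" if "z \<in> X" for z
    using I.a_repr_independence'[OF f[OF that] w] by simp
  with X show ?thesis
    by auto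
qed

lemma coset_memD:
  assumes I: "algebra_ideal K A I" and "x \<in> carrier A" "z \<in> I +> x"
  obtains h where "h \<in> I" "h \<in> carrier A" "z = h \<oplus> x"
  using assms subspace_subset[OF algebra_idealD(1)[OF I]] by (auto simp: a_r_coset_def')

lemma coset_memI: "h \<in> I \<Longrightarrow> h \<oplus> x \<in> I +> x"
  by (auto simp: a_r_coset_def')

lemma coset_self:
  "\<lbrakk>algebra_ideal K A I; x \<in> carrier A\<rbrakk> \<Longrightarrow> x \<in> I +> x"
  using abelian_subgroup.a_rcos_self[OF abelian_subgroup_ideal] by blast

text \<open>With h and k in \<open>I\<close>, the product (h + x)(k + y) differs from xy by h(k + y)
  + xk, which lies in the two-sided ideal \<open>I\<close>.\<close>

lemma coset_mult:
  assumes I: "algebra_ideal K A I" and x: "x \<in> carrier A" and y: "y \<in> carrier A"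
  shows "rcoset_mult A I (I +> x) (I +> y) = I +> x \<otimes> y"
proof -
  have *: "a \<otimes> b \<in> I +> x \<otimes> y" if ab: "a \<in> I +> x" "b \<in> I +> y" for a b
  proof -
    from ab obtain h k where h: "h \<in> I" "h \<in> carrier A" "a = h \<oplus> x"
      and k: "k \<in> I" "k \<in> carrier A" "b = k \<oplus> y"
      using coset_memD[OF I] x y by metis
    have "a \<otimes> b = (h \<otimes> (k \<oplus> y) \<oplus> x \<otimes> k) \<oplus> x \<otimes> y"
      using h k x y by (simp add: mult_add_left mult_add_right mult_closed M.a_ac)
    moreover have "h \<otimes> (k \<oplus> y) \<oplus> x \<otimes> k \<in> I"
      using h k x y algebra_idealD(2,3)[OF I] subspace_add[OF algebra_idealD(1)[OF I]] by simp
    ultimately show ?thesis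
      by (simp add: coset_memI)
  qed
  \<comment> \<open>\<open>rcoset_mult\<close> is a double union: the inner one over
    \<open>b\<close> collapses to a single coset that does not depend on \<open>a\<close>, and so
    the outer one collapses too.\<close>
  have "(\<Union>b\<in>I +> y. I +> a \<otimes> b) = I +> x \<otimes> y" if "a \<in> I +> x" for a
    using * that coset_self[OF I y] by (intro UN_coset_eq I mult_closed x y) auto
  then show ?thesis
    using coset_self[OF I x] by (auto simp: rcoset_mult_def)
qed

lemma coset_smult:
  assumes I: "algebra_ideal K A I" and c: "c \<in> carrier K" and x: "x \<in> carrier A"
  shows "(\<Union>z\<in>I +> x. I +> c \<odot> z) = I +> c \<odot> x"
proof (rule UN_coset_eq[OF I])
  show "I +> x \<noteq> {}"
    using coset_self[OF I x] by auto
  show "c \<odot> x \<in> carrier A"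
    using c x by simp
  fix z assume "z \<in> I +> x"
  then obtain h where h: "h \<in> I" "h \<in> carrier A" "z = h \<oplus> x"
    using coset_memD[OF I x] by metis
  then have "c \<odot> z = c \<odot> h \<oplus> c \<odot> x"
    using c x by (simp add: smult_r_distr)
  moreover have "c \<odot> h \<in> I"
    using c h subspace_smult[OF algebra_idealD(1)[OF I]] by simp
  ultimately show "c \<odot> z \<in> I +> c \<odot> x"
    by (simp add: coset_memI)
qed

text \<open>Reduces the operations of the quotient to representatives. The zero \<open>I\<close> is
  rewritten as the coset of zero so that all elements have the same form.\<close>

lemma
  assumes I: "algebra_ideal K A I"
  shows carrier_quotient: "carrier (quotient_algebra A I) = (+>) I ` carrier A"
    and zero_quotient: "\<zero>\<^bsub>quotient_algebra A I\<^esub> = I +> \<zero>"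
    and add_quotient: "\<lbrakk>x \<in> carrier A; y \<in> carrier A\<rbrakk>
      \<Longrightarrow> (I +> x) \<oplus>\<^bsub>quotient_algebra A I\<^esub> (I +> y) = I +> x \<oplus> y"
    and mult_quotient: "\<lbrakk>x \<in> carrier A; y \<in> carrier A\<rbrakk>
      \<Longrightarrow> (I +> x) \<otimes>\<^bsub>quotient_algebra A I\<^esub> (I +> y) = I +> x \<otimes> y"
    and smult_quotient: "\<lbrakk>c \<in> carrier K; x \<in> carrier A\<rbrakk>
      \<Longrightarrow> c \<odot>\<^bsub>quotient_algebra A I\<^esub> (I +> x) = I +> c \<odot> x"
proof -
  interpret I: abelian_subgroup I A
    by (rule abelian_subgroup_ideal[OF I])
  show "carrier (quotient_algebra A I) = (+>) I ` carrier A"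
    by (auto simp: quotient_algebra_def A_RCOSETS_def')
  show "\<zero>\<^bsub>quotient_algebra A I\<^esub> = I +> \<zero>"
    using I.a_subset by (simp add: quotient_algebra_def)
  show "(I +> x) \<oplus>\<^bsub>quotient_algebra A I\<^esub> (I +> y) = I +> x \<oplus> y"
    if "x \<in> carrier A" "y \<in> carrier A"
    using that by (simp add: quotient_algebra_def I.a_rcos_sum)
  show "(I +> x) \<otimes>\<^bsub>quotient_algebra A I\<^esub> (I +> y) = I +> x \<otimes> y"
    if "x \<in> carrier A" "y \<in> carrier A"
    using that by (simp add: quotient_algebra_def coset_mult[OF I])
  show "c \<odot>\<^bsub>quotient_algebra A I\<^esub> (I +> x) = I +> c \<odot> x"
    if "c \<in> carrier K" "x \<in> carrier A"
    using that by (simp add: quotient_algebra_def coset_smult[OF I])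
qed

text \<open>On representatives, each axiom for the quotient becomes the coset of the corresponding
  identity in \<open>A\<close>.\<close>

lemma quotient_nonassoc_algebra:
  assumes I: "algebra_ideal K A I"
  shows "nonassoc_algebra K (quotient_algebra A I)"
proof -
  note Q = carrier_quotient[OF I] zero_quotient[OF I] add_quotient[OF I] mult_quotient[OF I]
    smult_quotient[OF I]
  have neg: "\<exists>y\<in>carrier A. I +> x \<oplus> y = I +> \<zero>" if "x \<in> carrier A" for x
    using that by (intro bexI[of _ "\<ominus> x"]) (simp_all add: M.r_neg)
  have "vectorspace K (quotient_algebra A I)"
    \<comment> \<open>Deleting \<open>a_coset_add_zero\<close> keeps the zero in the form
      \<open>I +> \<zero>\<close>, to which the equations \<open>Q\<close> apply.\<close>
    by (rule vs_criteria)
      (auto simp: Q neg smult_l_distr smult_r_distr smult_assoc1 M.a_ac field_axioms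
        simp del: a_coset_add_zero)
  then show ?thesis
    by (intro nonassoc_algebra.intro nonassoc_algebra_axioms.intro)
      (auto simp: Q mult_closed mult_add_left mult_add_right mult_smult_left mult_smult_right)
qed

lemma quotient_hom:
  assumes I: "algebra_ideal K A I"
  shows "nonassoc_algebra_hom K A (quotient_algebra A I) ((+>) I)"
  using nonassoc_algebra_axioms quotient_nonassoc_algebra[OF I]
  by (auto simp: nonassoc_algebra_hom_def nonassoc_algebra_hom_axioms_def algebra_hom_def
      module_hom_def carrier_quotient[OF I] add_quotient[OF I] mult_quotient[OF I]
      smult_quotient[OF I])

text \<open>Identifies the kernel of the projection as \<open>I\<close>.\<close>

lemma coset_eq_zero_iff:
  assumes I: "algebra_ideal K A I" and x: "x \<in> carrier A"
  shows "I +> x = \<zero>\<^bsub>quotient_algebra A I\<^esub> \<longleftrightarrow> x \<in> I"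
proof -
  interpret I: abelian_subgroup I A
    by (rule abelian_subgroup_ideal[OF I])
  show ?thesis
    using I.a_rcos_const I.a_rcos_self[OF x] by (auto simp: quotient_algebra_def)
qed

text \<open>The projection has the solvable kernel \<open>R\<close>, so the preimage of a solvable
  ideal \<open>J\<close> of the quotient is solvable. By maximality it lies in \<open>R\<close>, and
  hence \<open>J\<close> contains only the zero coset.\<close>

lemma Rad_quotient:
  assumes R: "largest_solvable_ideal K A R"
  shows "Rad K (quotient_algebra A R) = {\<zero>\<^bsub>quotient_algebra A R\<^esub>}"
proof -
  let ?Q = "quotient_algebra A R"
  from R have sol: "solvable_ideal K A R" and max: "\<And>I. solvable_ideal K A I \<Longrightarrow> I \<subseteq> R"
    by (auto simp: largest_solvable_ideal_def)
  then have R: "algebra_ideal K A R"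
    by (simp add: solvable_ideal_iff)
  interpret \<pi>: nonassoc_algebra_hom K A ?Q "(+>) R"
    by (rule quotient_hom[OF R])
  have "{x \<in> carrier A. R +> x = \<zero>\<^bsub>?Q\<^esub>} = R"
    using coset_eq_zero_iff[OF R] subspace_subset[OF algebra_idealD(1)[OF R]] by blast
  with sol have ker: "solvable_ideal K A {x \<in> carrier A. R +> x = \<zero>\<^bsub>?Q\<^esub>}"
    by simp
  have "J \<subseteq> {\<zero>\<^bsub>?Q\<^esub>}" if J: "solvable_ideal K ?Q J" for J
  proof
    fix X assume "X \<in> J"
    moreover have "J \<subseteq> carrier ?Q"
      by (rule \<pi>.B.solvable_ideal_subset[OF J])
    ultimately obtain x where "x \<in> carrier A" "X = R +> x" "R +> x \<in> J"
      by (auto simp: carrier_quotient[OF R])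
    moreover from this have "x \<in> R"
      using max[OF \<pi>.solvable_ideal_vimage[OF ker J]] by blast
    ultimately show "X \<in> {\<zero>\<^bsub>?Q\<^esub>}"
      using coset_eq_zero_iff[OF R] by simp
  qed
  then show ?thesis
    using \<pi>.B.solvable_ideal_zero by (intro Rad_eqI) (simp add: largest_solvable_ideal_def)
qed

end

section \<open>Homomorphic images of the radical\<close>

lemma algebra_hom_onto_image:
  assumes "nonassoc_algebra_hom K A B \<phi>"
  shows "nonassoc_algebra_hom K A (subalg B (\<phi> ` carrier A)) \<phi>"
proof -
  interpret nonassoc_algebra_hom K A B \<phi> by fact
  have "nonassoc_algebra K (subalg B (\<phi> ` carrier A))"
  proof (rule B.subalg_nonassoc_algebra)
    show "subspace K (\<phi> ` carrier A) B"
      using lin.imT_is_subspace by (simp add: lin.im_def)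
    show "x \<otimes>\<^bsub>B\<^esub> y \<in> \<phi> ` carrier A"
      if "x \<in> \<phi> ` carrier A" "y \<in> \<phi> ` carrier A" for x y
      using that by (auto simp: mult_closed simp flip: hom_mult)
  qed
  then show ?thesis
    using hom A.nonassoc_algebra_axioms
    by (simp add: nonassoc_algebra_hom_def nonassoc_algebra_hom_axioms_def algebra_hom_def
        module_hom_def)
qed

text \<open>With the codomain cut down to the image, the map is surjective. It therefore sends the
  radical to a solvable ideal of the image, which lies in the largest one.\<close>

lemma image_Rad_subset:
  assumes "nonassoc_algebra_hom K A B \<phi>" and fd: "vectorspace.fin_dim K A"
  shows "\<phi> ` Rad K A \<subseteq> Rad K (subalg B (\<phi> ` carrier A))"
proof -
  interpret nonassoc_algebra_hom K A "subalg B (\<phi> ` carrier A)" \<phi>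
    by (rule algebra_hom_onto_image[OF assms(1)])
  have surj: "\<phi> ` carrier A = carrier (subalg B (\<phi> ` carrier A))"
    by simp
  have "solvable_ideal K A (Rad K A)"
    using A.Rad_largest_solvable_ideal[OF fd] by (simp add: largest_solvable_ideal_def)
  then show ?thesis
    using B.Rad_largest_solvable_ideal[OF fin_dim_image[OF surj fd]] solvable_ideal_image[OF surj]
    unfolding largest_solvable_ideal_def by blast
qed

theorem proposition1p4:
  fixes K :: "('k, 'r) ring_scheme"
    and A :: "('k, 'a, 'm) module_scheme"
  assumes "nonassoc_algebra K A"
    and "vectorspace.fin_dim K A"
  shows "largest_solvable_ideal K A (Rad K A)
    \<and> Rad K (subalg A (Rad K A)) = Rad K A
    \<and> Rad K (quotient_algebra A (Rad K A)) = {\<zero>\<^bsub>quotient_algebra A (Rad K A)\<^esub>}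
    \<and> (\<forall>(B :: ('k, 'b, 'n) module_scheme) \<phi>.
         nonassoc_algebra K B \<longrightarrow> \<phi> \<in> algebra_hom K A B \<longrightarrow>
         \<phi> ` Rad K A \<subseteq> Rad K (subalg B (\<phi> ` carrier A)))"
proof -
  interpret nonassoc_algebra K A by fact
  have R: "largest_solvable_ideal K A (Rad K A)"
    by (rule Rad_largest_solvable_ideal[OF assms(2)])
  have "\<phi> ` Rad K A \<subseteq> Rad K (subalg B (\<phi> ` carrier A))"
    if "nonassoc_algebra K B" "\<phi> \<in> algebra_hom K A B"
    for B :: "('k, 'b, 'n) module_scheme" and \<phi>
    using assms that
    by (intro image_Rad_subset nonassoc_algebra_hom.intro nonassoc_algebra_hom_axioms.intro)
  \<comment> \<open>Being a largest solvable ideal, the radical is in particular solvable, which is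
    the hypothesis behind (a).\<close>
  with R Rad_quotient[OF R] Rad_subalg_solvable_ideal show ?thesis
    by (auto simp: largest_solvable_ideal_def)
qed

end
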